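(* Let $(\mathcal{M}, g, A)$ be a K\"ahler manifold of dimension $n$ with a quarter-symmetric metric $A$-connection $\overset{1}{\nabla}_XY=\overset{g}{\nabla}_XY-\pi(X)AY$ with generator $\pi$. If the tensors $$\overset{1}{H}(X,Y)Z=\overset{1}{R}(X,Y)Z+\overset{1}{R}ic(Y,AX)AZ\quad\text{and}\quad \overset{2}{H}(X,Y)Z=\overset{2}{R}(X,Y)Z+\overset{2}{R}ic(AX,Z)AY-\overset{2}{R}ic(AY,Z)AX$$ vanish, then $$\overset{g}{P}(X,Y)Z=\frac{n-1}{n+2}\,\overset{g}{W}(X,Y)Z$$ for all vector fields $X,Y,Z$, where $\overset{g}{P}$ is the holomorphically projective curvature tensor and $\overset{g}{W}$ is the Weyl projective curvature tensor.
   Context: A K\"ahler manifold $(\mathcal{M},g,A)$ is a Riemannian manifold $(\mathcal{M},g)$ of dimension $n=2k\ge4$ with a $(1,1)$ tensor field $A$ satisfying $A^2=-I$, $g(AX,AY)=g(X,Y)$ and $\overset{g}{\nabla}A=0$, where $\overset{g}{\nabla}$ is the Levi-Civita connection. $\overset{g}{R}$ is the Riemannian curvature tensor of $g$, $\overset{g}{R}(X,Y)Z=\overset{g}{\nabla}_X\overset{g}{\nabla}_YZ-\overset{g}{\nabla}_Y\overset{g}{\nabla}_XZ-\overset{g}{\nabla}_{[X,Y]}Z$, and $\overset{g}{R}ic(Y,Z)=\mathrm{Trace}\{X\mapsto\overset{g}{R}(X,Y)Z\}$. Define $$\overset{g}{W}(X,Y)Z=\overset{g}{R}(X,Y)Z+\tfrac{1}{n-1}\big(\overset{g}{R}ic(X,Z)Y-\overset{g}{R}ic(Y,Z)X\big),$$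 $$\overset{g}{P}(X,Y)Z=\overset{g}{R}(X,Y)Z+\tfrac{1}{n+2}\big(\overset{g}{R}ic(X,Z)Y-\overset{g}{R}ic(Y,Z)X\big)-\tfrac{1}{n+2}\big(\overset{g}{R}ic(X,AZ)AY-\overset{g}{R}ic(Y,AZ)AX+2\overset{g}{R}ic(X,AY)AZ\big).$$ For a 1-form $\pi$, the curvature tensors of the first and second kind are $$\overset{1}{R}(X,Y)Z=\overset{g}{R}(X,Y)Z-\overset{1}{D}(X,Y)AZ,\qquad \overset{2}{R}(X,Y)Z=\overset{g}{R}(X,Y)Z-\overset{2}{D}(X,Z)AY+\overset{2}{D}(Y,Z)AX,$$ where $\overset{1}{D}(X,Y)=(\overset{g}{\nabla}_X\pi)(Y)-(\overset{g}{\nabla}_Y\pi)(X)$ and $\overset{2}{D}(X,Y)=(\overset{g}{\nabla}_X\pi)(Y)+\pi(Y)\pi(AX)$. For $\theta\in\{1,2\}$, $\overset{\theta}{R}ic(Y,Z)=\mathrm{Trace}\{X\mapsto\overset{\theta}{R}(X,Y)Z\}$. *)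

theory Defs
  imports "HOL-Analysis.Analysis"
begin

section \<open>Smooth manifolds\<close>

text \<open>
  \<open>Ck_on k f S\<close> is meant for open \<open>S\<close>.
\<close>

primrec Ck_on ::
    "nat \<Rightarrow> ('b::euclidean_space \<Rightarrow> 'c::real_normed_vector) \<Rightarrow> 'b set \<Rightarrow> bool" where
  "Ck_on 0 f S \<longleftrightarrow> continuous_on S f"
| "Ck_on (Suc k) f S \<longleftrightarrow>
     f differentiable_on S \<and> (\<forall>b\<in>Basis. Ck_on k (\<lambda>x. frechet_derivative f (at x) b) S)"

definition smooth_on :: "('b::euclidean_space \<Rightarrow> 'c::real_normed_vector) \<Rightarrow> 'b set \<Rightarrow> bool" where
  "smooth_on f S \<longleftrightarrow> (\<forall>k. Ck_on k f S)"

text \<open>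
  The manifold is the whole type \<^typ>\<open>'a\<close>, whose topology is Hausdorff and second countable
  by its type classes; its dimension is \<open>CARD('n)\<close>. A chart is a pair of a domain \<open>U\<close> and a
  coordinate map \<open>\<phi>\<close>, of which only the values on \<open>U\<close> matter. The atlas is not required to be
  maximal.
\<close>

type_synonym ('a, 'n) chart = "'a set \<times> ('a \<Rightarrow> real ^ 'n)"

definition smooth_atlas ::
    "('a::{t2_space, second_countable_topology}, 'n::finite) chart set \<Rightarrow> bool" where
  "smooth_atlas S \<longleftrightarrow>
     (\<forall>(U, \<phi>)\<in>S. open U \<and> open (\<phi> ` U) \<and> homeomorphism U (\<phi> ` U) \<phi> (inv_into U \<phi>)) \<and>
     (\<Union>(U, \<phi>)\<in>S. U) = UNIV \<and>
     (\<forall>(U, \<phi>)\<in>S. \<forall>(V, \<psi>)\<in>S. smooth_on (\<psi> \<circ> inv_into U \<phi>) (\<phi> ` (U \<inter> V)))"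

text \<open>Smoothness of a real function on an open subset \<open>W\<close> of the manifold.\<close>

definition smooth_fun_on ::
    "('a::topological_space, 'n::finite) chart set \<Rightarrow> 'a set \<Rightarrow> ('a \<Rightarrow> real) \<Rightarrow> bool" where
  "smooth_fun_on S W f \<longleftrightarrow> (\<forall>(U, \<phi>)\<in>S. smooth_on (f \<circ> inv_into U \<phi>) (\<phi> ` (U \<inter> W)))"

definition smooth_near ::
    "('a::topological_space, 'n::finite) chart set \<Rightarrow> 'a \<Rightarrow> ('a \<Rightarrow> real) \<Rightarrow> bool" where
  "smooth_near S p f \<longleftrightarrow> (\<exists>W. open W \<and> p \<in> W \<and> smooth_fun_on S W f)"


section \<open>Tangent vectors and vector fields\<close>

text \<open>
  A tangent vector at \<open>p\<close> is the operator of directional differentiation at \<open>p\<close> acting on functions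
  that are smooth near \<open>p\<close> (and sending all other functions to 0, so that equality of tangent
  vectors is equality of operators). A type of its own gives functionals the structure of a real
  vector space.
\<close>

datatype 'a functional = Functional (act: "('a \<Rightarrow> real) \<Rightarrow> real")

instantiation functional :: (type) real_vector
begin

definition "0 = Functional (\<lambda>f. 0)"
definition "v + w = Functional (\<lambda>f. act v f + act w f)"
definition "v - w = Functional (\<lambda>f. act v f - act w f)"
definition "- v = Functional (\<lambda>f. - act v f)"
definition "c *\<^sub>R v = Functional (\<lambda>f. c * act v f)"

instance
  by standard
    (simp_all add: zero_functional_def plus_functional_def minus_functional_def
      uminus_functional_def scaleR_functional_def algebra_simps)

end

definition coord_vector ::
    "('a::topological_space, 'n::finite) chart set \<Rightarrow> ('a, 'n) chart \<Rightarrow> 'a \<Rightarrow> real ^ 'n \<Rightarrow> 'a functional"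
  where
  "coord_vector S c p w = (case c of (U, \<phi>) \<Rightarrow>
     Functional (\<lambda>f. if smooth_near S p f
                     then frechet_derivative (f \<circ> inv_into U \<phi>) (at (\<phi> p)) w else 0))"

definition tangent_space ::
    "('a::topological_space, 'n::finite) chart set \<Rightarrow> 'a \<Rightarrow> 'a functional set" where
  "tangent_space S p = {coord_vector S (U, \<phi>) p w | U \<phi> w. (U, \<phi>) \<in> S \<and> p \<in> U}"

type_synonym 'a field = "'a \<Rightarrow> 'a functional"

definition deriv_along :: "'a field \<Rightarrow> ('a \<Rightarrow> real) \<Rightarrow> 'a \<Rightarrow> real" where
  "deriv_along X f p = act (X p) f"

definition vector_fields :: "('a::topological_space, 'n::finite) chart set \<Rightarrow> 'a field set" where
  "vector_fields S =
     {X. (\<forall>p. X p \<in> tangent_space S p) \<and>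
         (\<forall>W f. open W \<and> smooth_fun_on S W f \<longrightarrow> smooth_fun_on S W (deriv_along X f))}"

definition lie_bracket ::
    "('a::topological_space, 'n::finite) chart set \<Rightarrow> 'a field \<Rightarrow> 'a field \<Rightarrow> 'a field" where
  "lie_bracket S X Y p =
     Functional (\<lambda>f. if smooth_near S p f
       then act (X p) (deriv_along Y f) - act (Y p) (deriv_along X f) else 0)"


section \<open>Tensor fields and connections\<close>

definition one_form ::
    "('a::topological_space, 'n::finite) chart set \<Rightarrow> ('a \<Rightarrow> 'a functional \<Rightarrow> real) \<Rightarrow> bool" where
  "one_form S \<pi> \<longleftrightarrow>
     (\<forall>p. \<forall>v\<in>tangent_space S p. \<forall>w\<in>tangent_space S p. \<forall>c.
        \<pi> p (v + w) = \<pi> p v + \<pi> p w \<and> \<pi> p (c *\<^sub>R v) = c * \<pi> p v) \<and>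
     (\<forall>X\<in>vector_fields S. smooth_fun_on S UNIV (\<lambda>p. \<pi> p (X p)))"

definition app :: "('a \<Rightarrow> 'a functional \<Rightarrow> 'a functional) \<Rightarrow> 'a field \<Rightarrow> 'a field" where
  "app A X p = A p (X p)"

definition tensor11 ::
    "('a::topological_space, 'n::finite) chart set \<Rightarrow>
     ('a \<Rightarrow> 'a functional \<Rightarrow> 'a functional) \<Rightarrow> bool" where
  "tensor11 S A \<longleftrightarrow>
     (\<forall>p. \<forall>v\<in>tangent_space S p. \<forall>w\<in>tangent_space S p. \<forall>c.
        A p v \<in> tangent_space S p \<and>
        A p (v + w) = A p v + A p w \<and> A p (c *\<^sub>R v) = c *\<^sub>R A p v) \<and>
     (\<forall>X\<in>vector_fields S. app A X \<in> vector_fields S)"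

definition riemannian_metric ::
    "('a::topological_space, 'n::finite) chart set \<Rightarrow>
     ('a \<Rightarrow> 'a functional \<Rightarrow> 'a functional \<Rightarrow> real) \<Rightarrow> bool" where
  "riemannian_metric S g \<longleftrightarrow>
     (\<forall>p. \<forall>u\<in>tangent_space S p. \<forall>v\<in>tangent_space S p. \<forall>w\<in>tangent_space S p. \<forall>c.
        g p (u + v) w = g p u w + g p v w \<and> g p (c *\<^sub>R u) w = c * g p u w \<and>
        g p u v = g p v u \<and> (u \<noteq> 0 \<longrightarrow> g p u u > 0)) \<and>
     (\<forall>X\<in>vector_fields S. \<forall>Y\<in>vector_fields S. smooth_fun_on S UNIV (\<lambda>p. g p (X p) (Y p)))"

type_synonym 'a connection = "'a field \<Rightarrow> 'a field \<Rightarrow> 'a field"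

definition linear_connection ::
    "('a::topological_space, 'n::finite) chart set \<Rightarrow> 'a connection \<Rightarrow> bool" where
  "linear_connection S nabla \<longleftrightarrow>
     (\<forall>X\<in>vector_fields S. \<forall>Y\<in>vector_fields S. nabla X Y \<in> vector_fields S) \<and>
     (\<forall>X\<in>vector_fields S. \<forall>Y\<in>vector_fields S. \<forall>Z\<in>vector_fields S. \<forall>p.
        nabla (\<lambda>q. X q + Y q) Z p = nabla X Z p + nabla Y Z p \<and>
        nabla X (\<lambda>q. Y q + Z q) p = nabla X Y p + nabla X Z p) \<and>
     (\<forall>X\<in>vector_fields S. \<forall>Y\<in>vector_fields S. \<forall>f p. smooth_fun_on S UNIV f \<longrightarrow>
        nabla (\<lambda>q. f q *\<^sub>R X q) Y p = f p *\<^sub>R nabla X Y p \<and>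
        nabla X (\<lambda>q. f q *\<^sub>R Y q) p = deriv_along X f p *\<^sub>R Y p + f p *\<^sub>R nabla X Y p)"

definition torsion ::
    "('a::topological_space, 'n::finite) chart set \<Rightarrow> 'a connection \<Rightarrow> 'a field \<Rightarrow> 'a field \<Rightarrow> 'a field"
  where
  "torsion S nabla X Y p = nabla X Y p - nabla Y X p - lie_bracket S X Y p"

definition metric_connection ::
    "('a::topological_space, 'n::finite) chart set \<Rightarrow>
     ('a \<Rightarrow> 'a functional \<Rightarrow> 'a functional \<Rightarrow> real) \<Rightarrow> 'a connection \<Rightarrow> bool" where
  "metric_connection S g nabla \<longleftrightarrow>
     linear_connection S nabla \<and>
     (\<forall>X\<in>vector_fields S. \<forall>Y\<in>vector_fields S. \<forall>Z\<in>vector_fields S. \<forall>p.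
        deriv_along X (\<lambda>q. g q (Y q) (Z q)) p =
          g p (nabla X Y p) (Z p) + g p (Y p) (nabla X Z p))"

definition levi_civita_connection ::
    "('a::topological_space, 'n::finite) chart set \<Rightarrow>
     ('a \<Rightarrow> 'a functional \<Rightarrow> 'a functional \<Rightarrow> real) \<Rightarrow> 'a connection \<Rightarrow> bool" where
  "levi_civita_connection S g nabla \<longleftrightarrow>
     metric_connection S g nabla \<and>
     (\<forall>X\<in>vector_fields S. \<forall>Y\<in>vector_fields S. \<forall>p. torsion S nabla X Y p = 0)"

text \<open>\<open>\<nabla>A = 0\<close>, that is, \<open>\<nabla>\<^sub>X(AY) = A(\<nabla>\<^sub>XY)\<close>.\<close>

definition parallel11 ::
    "('a::topological_space, 'n::finite) chart set \<Rightarrow> 'a connection \<Rightarrow>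
     ('a \<Rightarrow> 'a functional \<Rightarrow> 'a functional) \<Rightarrow> bool" where
  "parallel11 S nabla A \<longleftrightarrow>
     (\<forall>X\<in>vector_fields S. \<forall>Y\<in>vector_fields S. \<forall>p.
        nabla X (app A Y) p - A p (nabla X Y p) = 0)"


section \<open>Kaehler manifolds and quarter-symmetric connections\<close>

definition kahler_manifold ::
    "('a::{t2_space, second_countable_topology}, 'n::finite) chart set \<Rightarrow>
     ('a \<Rightarrow> 'a functional \<Rightarrow> 'a functional \<Rightarrow> real) \<Rightarrow>
     ('a \<Rightarrow> 'a functional \<Rightarrow> 'a functional) \<Rightarrow> 'a connection \<Rightarrow> bool" where
  "kahler_manifold S g A nabla \<longleftrightarrow>
     smooth_atlas S \<and> even CARD('n) \<and> CARD('n) \<ge> 4 \<and>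
     riemannian_metric S g \<and> levi_civita_connection S g nabla \<and> tensor11 S A \<and>
     (\<forall>p. \<forall>v\<in>tangent_space S p. A p (A p v) = - v) \<and>
     (\<forall>p. \<forall>v\<in>tangent_space S p. \<forall>w\<in>tangent_space S p. g p (A p v) (A p w) = g p v w) \<and>
     parallel11 S nabla A"

definition quarter_symmetric_metric_A_connection ::
    "('a::topological_space, 'n::finite) chart set \<Rightarrow>
     ('a \<Rightarrow> 'a functional \<Rightarrow> 'a functional \<Rightarrow> real) \<Rightarrow>
     ('a \<Rightarrow> 'a functional \<Rightarrow> 'a functional) \<Rightarrow> ('a \<Rightarrow> 'a functional \<Rightarrow> real) \<Rightarrow>
     'a connection \<Rightarrow> bool" where
  "quarter_symmetric_metric_A_connection S g A \<pi> nabla \<longleftrightarrow>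
     metric_connection S g nabla \<and> parallel11 S nabla A \<and>
     (\<forall>X\<in>vector_fields S. \<forall>Y\<in>vector_fields S. \<forall>p.
        torsion S nabla X Y p = \<pi> p (Y p) *\<^sub>R A p (X p) - \<pi> p (X p) *\<^sub>R A p (Y p))"


section \<open>Curvature\<close>

text \<open>Arguments and values of the tensors below are vector fields.\<close>

type_synonym 'a tensor13 = "'a field \<Rightarrow> 'a field \<Rightarrow> 'a field \<Rightarrow> 'a field"

definition riemann ::
    "('a::topological_space, 'n::finite) chart set \<Rightarrow> 'a connection \<Rightarrow> 'a tensor13" where
  "riemann S nabla X Y Z p =
     nabla X (nabla Y Z) p - nabla Y (nabla X Z) p - nabla (lie_bracket S X Y) Z p"

text \<open>
  The trace of an endomorphism \<open>L\<close> of the finite-dimensional subspace \<open>V\<close>, computed in some basis.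
\<close>

definition trace_on :: "'v::real_vector set \<Rightarrow> ('v \<Rightarrow> 'v) \<Rightarrow> real" where
  "trace_on V L =
     (let B = (SOME B. finite B \<and> independent B \<and> span B = V)
      in \<Sum>b\<in>B. representation B (L b) b)"

definition extension ::
    "('a::topological_space, 'n::finite) chart set \<Rightarrow> 'a \<Rightarrow> 'a functional \<Rightarrow> 'a field" where
  "extension S p v = (SOME X. X \<in> vector_fields S \<and> X p = v)"

text \<open>
  The trace of \<open>X \<mapsto> T(X,Y)Z\<close> at \<open>p\<close>, for \<open>T\<close> tensorial in \<open>X\<close>: the value at \<open>p\<close> then depends on \<open>X\<close>
  only through the tangent vector \<open>X p\<close>, which is extended to a vector field to be plugged in.
\<close>

definition ricci ::
    "('a::topological_space, 'n::finite) chart set \<Rightarrow> 'a tensor13 \<Rightarrow> 'a field \<Rightarrow> 'a field \<Rightarrow> 'a \<Rightarrow> real"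
  where
  "ricci S T Y Z p = trace_on (tangent_space S p) (\<lambda>v. T (extension S p v) Y Z p)"

definition weyl_projective ::
    "('a::topological_space, 'n::finite) chart set \<Rightarrow> 'a connection \<Rightarrow> 'a tensor13" where
  "weyl_projective S nabla X Y Z p =
     (let n = real CARD('n); Rm = riemann S nabla; Ric = ricci S Rm in
      Rm X Y Z p + (1 / (n - 1)) *\<^sub>R (Ric X Z p *\<^sub>R Y p - Ric Y Z p *\<^sub>R X p))"

definition holomorphically_projective ::
    "('a::topological_space, 'n::finite) chart set \<Rightarrow>
     ('a \<Rightarrow> 'a functional \<Rightarrow> 'a functional) \<Rightarrow> 'a connection \<Rightarrow> 'a tensor13" where
  "holomorphically_projective S A nabla X Y Z p =
     (let n = real CARD('n); Rm = riemann S nabla; Ric = ricci S Rm in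
      Rm X Y Z p
      + (1 / (n + 2)) *\<^sub>R (Ric X Z p *\<^sub>R Y p - Ric Y Z p *\<^sub>R X p)
      - (1 / (n + 2)) *\<^sub>R
          (Ric X (app A Z) p *\<^sub>R app A Y p - Ric Y (app A Z) p *\<^sub>R app A X p
           + (2 * Ric X (app A Y) p) *\<^sub>R app A Z p))"

definition cov_deriv_form ::
    "'a connection \<Rightarrow> ('a \<Rightarrow> 'a functional \<Rightarrow> real) \<Rightarrow> 'a field \<Rightarrow> 'a field \<Rightarrow> 'a \<Rightarrow> real" where
  "cov_deriv_form nabla \<pi> X Y p = deriv_along X (\<lambda>q. \<pi> q (Y q)) p - \<pi> p (nabla X Y p)"

definition D1 ::
    "'a connection \<Rightarrow> ('a \<Rightarrow> 'a functional \<Rightarrow> real) \<Rightarrow> 'a field \<Rightarrow> 'a field \<Rightarrow> 'a \<Rightarrow> real" where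
  "D1 nabla \<pi> X Y p = cov_deriv_form nabla \<pi> X Y p - cov_deriv_form nabla \<pi> Y X p"

definition D2 ::
    "('a \<Rightarrow> 'a functional \<Rightarrow> 'a functional) \<Rightarrow> 'a connection \<Rightarrow> ('a \<Rightarrow> 'a functional \<Rightarrow> real) \<Rightarrow>
     'a field \<Rightarrow> 'a field \<Rightarrow> 'a \<Rightarrow> real" where
  "D2 A nabla \<pi> X Y p = cov_deriv_form nabla \<pi> X Y p + \<pi> p (Y p) * \<pi> p (app A X p)"

definition curvature1 ::
    "('a::topological_space, 'n::finite) chart set \<Rightarrow>
     ('a \<Rightarrow> 'a functional \<Rightarrow> 'a functional) \<Rightarrow> 'a connection \<Rightarrow>
     ('a \<Rightarrow> 'a functional \<Rightarrow> real) \<Rightarrow> 'a tensor13" where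
  "curvature1 S A nabla \<pi> X Y Z p =
     riemann S nabla X Y Z p - D1 nabla \<pi> X Y p *\<^sub>R app A Z p"

definition curvature2 ::
    "('a::topological_space, 'n::finite) chart set \<Rightarrow>
     ('a \<Rightarrow> 'a functional \<Rightarrow> 'a functional) \<Rightarrow> 'a connection \<Rightarrow>
     ('a \<Rightarrow> 'a functional \<Rightarrow> real) \<Rightarrow> 'a tensor13" where
  "curvature2 S A nabla \<pi> X Y Z p =
     riemann S nabla X Y Z p - D2 A nabla \<pi> X Z p *\<^sub>R app A Y p + D2 A nabla \<pi> Y Z p *\<^sub>R app A X p"

definition H1 ::
    "('a::topological_space, 'n::finite) chart set \<Rightarrow>
     ('a \<Rightarrow> 'a functional \<Rightarrow> 'a functional) \<Rightarrow> 'a connection \<Rightarrow>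
     ('a \<Rightarrow> 'a functional \<Rightarrow> real) \<Rightarrow> 'a tensor13" where
  "H1 S A nabla \<pi> X Y Z p =
     (let R1 = curvature1 S A nabla \<pi> in
      R1 X Y Z p + ricci S R1 Y (app A X) p *\<^sub>R app A Z p)"

definition H2 ::
    "('a::topological_space, 'n::finite) chart set \<Rightarrow>
     ('a \<Rightarrow> 'a functional \<Rightarrow> 'a functional) \<Rightarrow> 'a connection \<Rightarrow>
     ('a \<Rightarrow> 'a functional \<Rightarrow> real) \<Rightarrow> 'a tensor13" where
  "H2 S A nabla \<pi> X Y Z p =
     (let R2 = curvature2 S A nabla \<pi> in
      R2 X Y Z p + ricci S R2 (app A X) Z p *\<^sub>R app A Y p - ricci S R2 (app A Y) Z p *\<^sub>R app A X p)"

end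

theory Submission
  imports Defs "HOL-Computational_Algebra.Polynomial"
begin

text \<open>
  The traces in \<open>H1 = 0\<close> and \<open>H2 = 0\<close> need not be computed. At each point the two equations have
  the form \<open>R(X,Y)Z = c(X,Y) AZ\<close> and \<open>R(X,Y)Z = a(X,Z) AY - a(Y,Z) AX\<close>. Since \<open>A\<close> is injective on
  the tangent space, whose dimension exceeds 2, a vector field \<open>Z\<close> with value outside the span of
  \<open>X\<close> and \<open>Y\<close> forces \<open>c(X,Y) = 0\<close>. So \<open>R = 0\<close>, and both sides of the claim vanish. Such a \<open>Z\<close>, and
  the extensions implicit in the Ricci tensor, are obtained with a smooth bump function in a chart.
\<close>


section \<open>Calculus of \<open>Ck_on\<close>\<close>

text \<open>A derivative at a point depends on the values nearby, so agreement on \<open>S\<close>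
  passes to the derivatives because \<open>S\<close> is open.\<close>

lemma Ck_on_cong:
  assumes "open S" "\<And>x. x \<in> S \<Longrightarrow> f x = g x" "Ck_on k f S"
  shows "Ck_on k g S"
  using assms(2,3)
proof (induction k arbitrary: f g)
  case 0
  then show ?case by (simp cong: continuous_on_cong)
next
  case (Suc k)
  have d: "f differentiable at x" if "x \<in> S" for x
    using Suc.prems(2) that assms(1) by (simp add: differentiable_on_eq_differentiable_at)
  have e: "frechet_derivative f (at x) = frechet_derivative g (at x)" if "x \<in> S" for x
    by (rule frechet_derivative_transform_within_open[OF d[OF that] assms(1) that Suc.prems(1)])
  have "g differentiable_on S"
    using Suc.prems by (auto simp: differentiable_on_def intro: differentiable_transform_within[of _ _ _ 1])
  moreover have "Ck_on k (\<lambda>x. frechet_derivative g (at x) b) S" if "b \<in> Basis" for b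
    by (rule Suc.IH[of "\<lambda>x. frechet_derivative f (at x) b"]) (use e Suc.prems(2) that in auto)
  ultimately show ?case by simp
qed

lemma Ck_on_subset: "Ck_on k f S \<Longrightarrow> T \<subseteq> S \<Longrightarrow> Ck_on k f T"
  by (induction k arbitrary: f) (auto intro: continuous_on_subset differentiable_on_subset)

text \<open>Continuity and differentiability at a point see only a neighbourhood of it, and the
  derivative \<open>at x\<close> does not mention the set, so the partial derivatives inherit the
  same cover.\<close>

lemma Ck_on_open_cover:
  assumes "\<And>x. x \<in> S \<Longrightarrow> \<exists>T. open T \<and> x \<in> T \<and> Ck_on k f T"
  shows "Ck_on k f S"
  using assms
proof (induction k arbitrary: f)
  case 0
  have "continuous (at x) f" if "x \<in> S" for x
    using 0[OF that] by (auto simp: continuous_on_eq_continuous_at)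
  then show ?case by (simp add: continuous_at_imp_continuous_on)
next
  case (Suc k)
  have "f differentiable at x" if "x \<in> S" for x
    using Suc.prems[OF that] by (auto simp: differentiable_on_eq_differentiable_at)
  then have "f differentiable_on S" by (simp add: differentiable_at_imp_differentiable_on)
  moreover have "Ck_on k (\<lambda>x. frechet_derivative f (at x) b) S" if "b \<in> Basis" for b
    by (rule Suc.IH) (use Suc.prems that in auto)
  ultimately show ?case by simp
qed

lemma Ck_on_Suc_imp_Ck_on: "Ck_on (Suc k) f S \<Longrightarrow> Ck_on k f S"
proof (induction k arbitrary: f)
  case 0
  then show ?case by (simp add: differentiable_imp_continuous_on)
next
  case (Suc k)
  then show ?case by (metis Ck_on.simps(2))
qed

lemma Ck_on_const: "Ck_on k (\<lambda>x. c) S"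
  by (induction k arbitrary: c) simp_all

lemma Ck_on_bounded_linear:
  assumes "bounded_linear L"
  shows "Ck_on k L S"
proof (cases k)
  case 0
  then show ?thesis by (simp add: assms linear_continuous_on)
next
  case (Suc m)
  have "frechet_derivative L (at x) = L" for x
    using frechet_derivative_at[OF bounded_linear_imp_has_derivative[OF assms]] by simp
  then show ?thesis
    using Suc by (simp add: Ck_on_const bounded_linear_imp_differentiable_on[OF assms])
qed

lemma Ck_on_bounded_linear_compose:
  assumes L: "bounded_linear L" and S: "open S" and f: "Ck_on k f S"
  shows "Ck_on k (\<lambda>x. L (f x)) S"
  using f
proof (induction k arbitrary: f)
  case 0
  then show ?case by (simp add: bounded_linear.continuous_on[OF L])
next
  case (Suc k)
  have d: "(f has_derivative frechet_derivative f (at x)) (at x)" if "x \<in> S" for x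
    using Suc.prems that S
    by (simp add: differentiable_on_eq_differentiable_at frechet_derivative_works[symmetric])
  have d': "((\<lambda>x. L (f x)) has_derivative (\<lambda>v. L (frechet_derivative f (at x) v))) (at x)"
    if "x \<in> S" for x
    by (rule bounded_linear.has_derivative[OF L d[OF that]])
  have "(\<lambda>x. L (f x)) differentiable_on S"
    using d' S by (auto simp: differentiable_on_eq_differentiable_at differentiable_def)
  moreover have "Ck_on k (\<lambda>x. frechet_derivative (\<lambda>x. L (f x)) (at x) b) S" if "b \<in> Basis" for b
    by (rule Ck_on_cong[OF S _ Suc.IH[of "\<lambda>x. frechet_derivative f (at x) b"]])
      (use frechet_derivative_at[OF d'] Suc.prems that in \<open>auto dest: fun_cong\<close>)
  ultimately show ?case by simp
qed

lemma Ck_on_add: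
  assumes S: "open S" and "Ck_on k f S" "Ck_on k g S"
  shows "Ck_on k (\<lambda>x. f x + g x) S"
  using assms(2,3)
proof (induction k arbitrary: f g)
  case 0
  then show ?case by (simp add: continuous_on_add)
next
  case (Suc k)
  have d: "f differentiable at x" "g differentiable at x" if "x \<in> S" for x
    using Suc.prems that S by (auto simp: differentiable_on_eq_differentiable_at)
  have d': "((\<lambda>x. f x + g x) has_derivative
      (\<lambda>v. frechet_derivative f (at x) v + frechet_derivative g (at x) v)) (at x)"
    if "x \<in> S" for x
    by (intro has_derivative_add) (use d[OF that] in \<open>simp_all add: frechet_derivative_works[symmetric]\<close>)
  have "(\<lambda>x. f x + g x) differentiable_on S"
    using d' S by (auto simp: differentiable_on_eq_differentiable_at differentiable_def)
  moreover have "Ck_on k (\<lambda>x. frechet_derivative (\<lambda>x. f x + g x) (at x) b) S" if "b \<in> Basis" for b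
    by (rule Ck_on_cong[OF S _ Suc.IH[of "\<lambda>x. frechet_derivative f (at x) b"
          "\<lambda>x. frechet_derivative g (at x) b"]])
      (use frechet_derivative_at[OF d'] Suc.prems that in \<open>auto dest: fun_cong\<close>)
  ultimately show ?case by simp
qed

lemma Ck_on_sum:
  assumes "open S" "\<And>i. i \<in> I \<Longrightarrow> Ck_on k (f i) S"
  shows "Ck_on k (\<lambda>x. \<Sum>i\<in>I. f i x) S"
  using assms(2)
  by (induction I rule: infinite_finite_induct) (simp_all add: Ck_on_const Ck_on_add assms(1))

text \<open>Leibniz rule. Each summand keeps one factor undifferentiated;
  \<open>Ck_on_Suc_imp_Ck_on\<close> lowers the order of that factor so that the induction
  hypothesis applies.\<close>

lemma Ck_on_scaleR:
  fixes f :: "'b::euclidean_space \<Rightarrow> real"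
  assumes S: "open S" and "Ck_on k f S" "Ck_on k g S"
  shows "Ck_on k (\<lambda>x. f x *\<^sub>R g x) S"
  using assms(2,3)
proof (induction k arbitrary: f g)
  case 0
  then show ?case by (simp add: continuous_on_scaleR)
next
  case (Suc k)
  have d: "f differentiable at x" "g differentiable at x" if "x \<in> S" for x
    using Suc.prems that S by (auto simp: differentiable_on_eq_differentiable_at)
  have d': "((\<lambda>x. f x *\<^sub>R g x) has_derivative
      (\<lambda>v. f x *\<^sub>R frechet_derivative g (at x) v + frechet_derivative f (at x) v *\<^sub>R g x)) (at x)"
    if "x \<in> S" for x
    by (intro has_derivative_scaleR) (use d[OF that] in \<open>simp_all add: frechet_derivative_works[symmetric]\<close>)
  have "(\<lambda>x. f x *\<^sub>R g x) differentiable_on S"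
    using d' S by (auto simp: differentiable_on_eq_differentiable_at differentiable_def)
  moreover have "Ck_on k (\<lambda>x. frechet_derivative (\<lambda>x. f x *\<^sub>R g x) (at x) b) S"
    if b: "b \<in> Basis" for b
  proof (rule Ck_on_cong[OF S])
    show "f x *\<^sub>R frechet_derivative g (at x) b + frechet_derivative f (at x) b *\<^sub>R g x
        = frechet_derivative (\<lambda>x. f x *\<^sub>R g x) (at x) b" if "x \<in> S" for x
      using fun_cong[OF frechet_derivative_at[OF d'[OF that]]] .
    show "Ck_on k (\<lambda>x. f x *\<^sub>R frechet_derivative g (at x) b + frechet_derivative f (at x) b *\<^sub>R g x) S"
      using Suc.prems b Suc.prems[THEN Ck_on_Suc_imp_Ck_on] by (intro Ck_on_add[OF S] Suc.IH) auto
  qed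
  ultimately show ?case by simp
qed

text \<open>Chain rule in coordinates: a partial derivative of \<open>g \<circ> f\<close> is a sum
  of products of components of a partial derivative of \<open>f\<close> with partial derivatives of
  \<open>g\<close> composed with \<open>f\<close>. The inner map stays the same, so the induction
  generalises only over \<open>g\<close>.\<close>

lemma Ck_on_compose:
  fixes f :: "'b::euclidean_space \<Rightarrow> 'c::euclidean_space" and g :: "'c \<Rightarrow> 'd::real_normed_vector"
  assumes S: "open S" and T: "open T" and fST: "f ` S \<subseteq> T"
    and "Ck_on k f S" "Ck_on k g T"
  shows "Ck_on k (g \<circ> f) S"
  using fST assms(4,5)
proof (induction k arbitrary: g)
  case 0
  then show ?case unfolding Ck_on.simps by (metis continuous_on_compose continuous_on_subset)
next
  case (Suc k)
  have f: "f differentiable at x" if "x \<in> S" for x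
    using Suc.prems that S by (auto simp: differentiable_on_eq_differentiable_at)
  have g: "g differentiable at (f x)" if "x \<in> S" for x
    using Suc.prems that T by (auto simp: differentiable_on_eq_differentiable_at)
  have d': "((g \<circ> f) has_derivative
      (frechet_derivative g (at (f x)) \<circ> frechet_derivative f (at x))) (at x)"
    if "x \<in> S" for x
    by (intro diff_chain_at) (use f[OF that] g[OF that] in \<open>simp_all add: frechet_derivative_works[symmetric]\<close>)
  have "(g \<circ> f) differentiable_on S"
    using d' S by (auto simp: differentiable_on_eq_differentiable_at differentiable_def)
  moreover have "Ck_on k (\<lambda>x. frechet_derivative (g \<circ> f) (at x) b) S"
    if b: "b \<in> Basis" for b
  proof (rule Ck_on_cong[OF S])
    fix x assume x: "x \<in> S"
    let ?D = "frechet_derivative g (at (f x))" and ?v = "frechet_derivative f (at x) b"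
    have lin: "linear ?D"
      using linear_frechet_derivative[OF g[OF x]] .
    have "(\<Sum>c\<in>Basis. (?v \<bullet> c) *\<^sub>R ?D c) = ?D (\<Sum>c\<in>Basis. (?v \<bullet> c) *\<^sub>R c)"
      by (simp add: linear_sum[OF lin] linear_cmul[OF lin])
    also have "\<dots> = frechet_derivative (g \<circ> f) (at x) b"
      using fun_cong[OF frechet_derivative_at[OF d'[OF x]], of b] by (simp add: euclidean_representation)
    finally show "(\<Sum>c\<in>Basis. (frechet_derivative f (at x) b \<bullet> c) *\<^sub>R
        ((\<lambda>y. frechet_derivative g (at y) c) \<circ> f) x) = frechet_derivative (g \<circ> f) (at x) b"
      by simp
  next
    show "Ck_on k (\<lambda>x. \<Sum>c\<in>Basis. (frechet_derivative f (at x) b \<bullet> c) *\<^sub>R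
        ((\<lambda>y. frechet_derivative g (at y) c) \<circ> f) x) S"
    proof (intro Ck_on_sum[OF S] Ck_on_scaleR[OF S])
      fix c :: 'c assume c: "c \<in> Basis"
      show "Ck_on k (\<lambda>x. frechet_derivative f (at x) b \<bullet> c) S"
        using Suc.prems b by (intro Ck_on_bounded_linear_compose[OF bounded_linear_inner_left S]) auto
      show "Ck_on k ((\<lambda>y. frechet_derivative g (at y) c) \<circ> f) S"
        using Suc.prems c Suc.prems(2)[THEN Ck_on_Suc_imp_Ck_on] by (intro Suc.IH) auto
    qed
  qed
  ultimately show ?case unfolding Ck_on.simps by blast
qed

section \<open>Closure properties of smooth maps\<close>

lemma smooth_on_cong:
  "open S \<Longrightarrow> (\<And>x. x \<in> S \<Longrightarrow> f x = g x) \<Longrightarrow> smooth_on f S \<Longrightarrow> smooth_on g S"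
  unfolding smooth_on_def using Ck_on_cong by blast

lemma smooth_on_subset: "smooth_on f S \<Longrightarrow> T \<subseteq> S \<Longrightarrow> smooth_on f T"
  unfolding smooth_on_def using Ck_on_subset by blast

lemma smooth_on_open_cover:
  assumes "\<And>x. x \<in> S \<Longrightarrow> \<exists>T. open T \<and> x \<in> T \<and> smooth_on f T"
  shows "smooth_on f S"
  unfolding smooth_on_def
  by (intro allI Ck_on_open_cover) (use assms in \<open>unfold smooth_on_def, blast\<close>)

lemma smooth_on_const: "smooth_on (\<lambda>x. c) S"
  by (simp add: smooth_on_def Ck_on_const)

lemma smooth_on_scaleR:
  fixes f :: "'b::euclidean_space \<Rightarrow> real"
  shows "open S \<Longrightarrow> smooth_on f S \<Longrightarrow> smooth_on g S \<Longrightarrow> smooth_on (\<lambda>x. f x *\<^sub>R g x) S"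
  by (simp add: smooth_on_def Ck_on_scaleR)

lemma smooth_on_compose:
  fixes f :: "'b::euclidean_space \<Rightarrow> 'c::euclidean_space" and g :: "'c \<Rightarrow> 'd::real_normed_vector"
  shows "open S \<Longrightarrow> open T \<Longrightarrow> f ` S \<subseteq> T \<Longrightarrow> smooth_on f S \<Longrightarrow> smooth_on g T \<Longrightarrow> smooth_on (g \<circ> f) S"
  by (simp add: smooth_on_def Ck_on_compose)

lemma smooth_on_bounded_linear_compose:
  "bounded_linear L \<Longrightarrow> open S \<Longrightarrow> smooth_on f S \<Longrightarrow> smooth_on (\<lambda>x. L (f x)) S"
  by (simp add: smooth_on_def Ck_on_bounded_linear_compose)

lemma smooth_on_imp_differentiable_at:
  "smooth_on f S \<Longrightarrow> open S \<Longrightarrow> x \<in> S \<Longrightarrow> f differentiable at x"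
  unfolding smooth_on_def using differentiable_on_eq_differentiable_at Ck_on.simps(2) by blast

text \<open>\<open>Ck_on\<close> controls derivatives in basis directions only; linearity of the
  derivative reduces a general direction \<open>w\<close> to these.\<close>

lemma smooth_on_frechet_derivative:
  assumes f: "smooth_on f S" and S: "open S"
  shows "smooth_on (\<lambda>x. frechet_derivative f (at x) w) S"
proof (rule smooth_on_cong[OF S])
  show "(\<Sum>b\<in>Basis. (w \<bullet> b) *\<^sub>R frechet_derivative f (at x) b) = frechet_derivative f (at x) w"
    if "x \<in> S" for x
  proof -
    have lin: "linear (frechet_derivative f (at x))"
      using linear_frechet_derivative smooth_on_imp_differentiable_at[OF f S that] by blast
    show ?thesis
      using linear_sum[OF lin, of "\<lambda>b. (w \<bullet> b) *\<^sub>R b" Basis]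
      by (simp add: linear_cmul[OF lin] euclidean_representation)
  qed
  have "Ck_on k (\<lambda>x. frechet_derivative f (at x) b) S" if "b \<in> Basis" for k b
    using f that Ck_on.simps(2) unfolding smooth_on_def by blast
  then show "smooth_on (\<lambda>x. \<Sum>b\<in>Basis. (w \<bullet> b) *\<^sub>R frechet_derivative f (at x) b) S"
    unfolding smooth_on_def
    by (intro allI Ck_on_sum[OF S] Ck_on_scaleR[OF S] Ck_on_const)
qed


section \<open>Bump functions\<close>

text \<open>The polynomial factor makes the family closed under differentiation, so that all orders
  can be treated by one induction. \<open>P = 1\<close> gives the usual flat function
  exp(-1/t).\<close>

definition flat_exp :: "real poly \<Rightarrow> real \<Rightarrow> real" where
  "flat_exp P t = (if t > 0 then poly P (1 / t) * exp (- (1 / t)) else 0)"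

lemma poly_times_exp_minus_tendsto_0:
  fixes P :: "real poly"
  shows "((\<lambda>x. poly P x * exp (- x)) \<longlongrightarrow> 0) at_top"
proof -
  have "((\<lambda>x. \<Sum>i\<le>degree P. coeff P i * (x ^ i / exp x)) \<longlongrightarrow> (\<Sum>i\<le>degree P. coeff P i * 0)) at_top"
    by (intro tendsto_intros tendsto_power_div_exp_0)
  then show ?thesis
    by (simp add: poly_altdef sum_distrib_right exp_minus divide_inverse mult.assoc)
qed

text \<open>From the right, substitute x = 1/t, where the exponential beats every polynomial; from
  the left the function is zero.\<close>

lemma flat_exp_tendsto_0: "(flat_exp P \<longlongrightarrow> 0) (at 0)"
proof -
  have "((\<lambda>t. poly P (1 / t) * exp (- (1 / t))) \<longlongrightarrow> 0) (at_right 0)"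
    using filterlim_compose[OF poly_times_exp_minus_tendsto_0 filterlim_inverse_at_top_right]
    by (simp add: inverse_eq_divide)
  moreover have "\<forall>\<^sub>F t in at_right 0. poly P (1 / t) * exp (- (1 / t)) = flat_exp P t"
    using eventually_at_right_less[of "0::real"] by eventually_elim (simp add: flat_exp_def)
  ultimately have r: "(flat_exp P \<longlongrightarrow> 0) (at_right 0)"
    by (rule Lim_transform_eventually)
  have "\<forall>\<^sub>F t in at_left 0. 0 = flat_exp P t"
    by (auto simp: flat_exp_def eventually_at_filter)
  then have l: "(flat_exp P \<longlongrightarrow> 0) (at_left 0)"
    by (rule Lim_transform_eventually[OF tendsto_const])
  show ?thesis using r l filterlim_at_split by blast
qed

text \<open>For t > 0 and s = 1/t, differentiating P(s) exp(-s) in t gives s^2 (P(s) - P'(s))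
  exp(-s), which explains the factor \<open>[:0, 0, 1:]\<close>.\<close>

lemma flat_exp_has_real_derivative:
  "(flat_exp P has_real_derivative flat_exp ([:0, 0, 1:] * (P - pderiv P)) t) (at t)"
proof (cases t "0::real" rule: linorder_cases)
  case less
  have "((\<lambda>t. 0) has_real_derivative 0) (at t)" by simp
  then have "(flat_exp P has_real_derivative 0) (at t)"
    by (rule has_field_derivative_transform_within_open[of _ _ _ "{..<0}"])
      (use less in \<open>auto simp: flat_exp_def\<close>)
  with less show ?thesis by (simp add: flat_exp_def)
next
  case equal
  \<comment> \<open>Dividing by h multiplies the polynomial in 1/h by its variable, so the
    difference quotient at 0 lies again in the family and tends to 0. At h = 0 both sides are 0
    because division by zero yields 0.\<close>
  have "(\<lambda>h. (flat_exp P (0 + h) - flat_exp P 0) / h) = flat_exp (pCons 0 P)"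
    by (auto simp: flat_exp_def fun_eq_iff)
  then show ?thesis
    using flat_exp_tendsto_0[of "pCons 0 P"] equal by (simp add: DERIV_def) (simp add: flat_exp_def)
next
  case greater
  have "((\<lambda>t. poly P (1 / t) * exp (- (1 / t))) has_real_derivative
      flat_exp ([:0, 0, 1:] * (P - pderiv P)) t) (at t)"
    using greater
    by (auto intro!: derivative_eq_intros DERIV_chain2[OF poly_DERIV]
        simp: flat_exp_def divide_simps) (simp add: algebra_simps)
  then show ?thesis
    by (rule has_field_derivative_transform_within_open[of _ _ _ "{0<..}"])
      (use greater in \<open>auto simp: flat_exp_def\<close>)
qed

lemma Ck_on_flat_exp: "Ck_on k (flat_exp P) S"
proof (induction k arbitrary: P)
  case 0
  show ?case
    using DERIV_isCont[OF flat_exp_has_real_derivative]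
    by (simp add: continuous_at_imp_continuous_on)
next
  case (Suc k)
  let ?Q = "[:0, 0, 1:] * (P - pderiv P)"
  have "frechet_derivative (flat_exp P) (at x) = (*) (flat_exp ?Q x)" for x
    using frechet_derivative_at[OF has_field_derivative_imp_has_derivative[OF
          flat_exp_has_real_derivative[of P x]]] by simp
  moreover have "flat_exp P differentiable at x" for x
    using flat_exp_has_real_derivative real_differentiable_def by blast
  ultimately show ?case
    using Suc[of ?Q] by (simp add: differentiable_at_imp_differentiable_on)
qed

text \<open>The bump is exp(-1/u) continued by zero, with u = r^2 - |x - a|^2: positive at the
  centre and at most 0 outside the ball.\<close>

lemma exists_smooth_bump:
  fixes a :: "'b::euclidean_space"
  assumes "r > 0"
  obtains \<beta> :: "'b \<Rightarrow> real"
  where "smooth_on \<beta> UNIV" "\<beta> a \<noteq> 0" "\<And>x. x \<notin> cball a r \<Longrightarrow> \<beta> x = 0"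
proof
  \<comment> \<open>The squared norm is spelled out with sums and \<open>scaleR\<close> so that the
    closure lemmas for \<open>Ck_on\<close> apply to it directly.\<close>
  let ?u = "\<lambda>x. r\<^sup>2 + (- 1) *\<^sub>R (\<Sum>b\<in>Basis. ((x + - a) \<bullet> b) *\<^sub>R ((x + - a) \<bullet> b))"
  have u: "?u x = r\<^sup>2 - (norm (x - a))\<^sup>2" for x
    using euclidean_inner[of "x - a" "x - a"] by (simp add: power2_norm_eq_inner)
  have inner: "Ck_on k (\<lambda>x. (x + - a) \<bullet> b) UNIV" for k b
    by (rule Ck_on_bounded_linear_compose[OF bounded_linear_inner_left open_UNIV])
      (rule Ck_on_add[OF open_UNIV Ck_on_bounded_linear[OF bounded_linear_ident] Ck_on_const])
  have "Ck_on k ?u UNIV" for k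
    by (rule Ck_on_add[OF open_UNIV Ck_on_const Ck_on_scaleR[OF open_UNIV Ck_on_const
          Ck_on_sum[OF open_UNIV Ck_on_scaleR[OF open_UNIV inner inner]]]])
  then show "smooth_on (flat_exp 1 \<circ> ?u) UNIV"
    unfolding smooth_on_def
    by (intro allI Ck_on_compose[OF open_UNIV open_UNIV subset_UNIV]) (simp_all add: Ck_on_flat_exp)
  show "(flat_exp 1 \<circ> ?u) a \<noteq> 0"
    using assms by (simp add: flat_exp_def)
  show "(flat_exp 1 \<circ> ?u) x = 0" if "x \<notin> cball a r" for x
  proof -
    have "r\<^sup>2 \<le> (norm (x - a))\<^sup>2"
      using that assms by (intro power_mono) (auto simp: dist_norm norm_minus_commute)
    then show ?thesis using u[of x] by (simp add: flat_exp_def)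
  qed
qed


section \<open>Tangent spaces and extension of tangent vectors\<close>

lemma act_simps [simp]:
  "act 0 f = 0" "act (v + w) f = act v f + act w f" "act (c *\<^sub>R v) f = c * act v f"
  by (simp_all add: zero_functional_def plus_functional_def scaleR_functional_def)

lemma functional_eqI: "(\<And>f. act v f = act w f) \<Longrightarrow> v = w"
  by (cases v; cases w) auto

lemma act_coord_vector:
  "act (coord_vector S (U, \<phi>) p w) f =
     (if smooth_near S p f then frechet_derivative (f \<circ> inv_into U \<phi>) (at (\<phi> p)) w else 0)"
  by (simp add: coord_vector_def)

context
  fixes S :: "('a::{t2_space, second_countable_topology}, 'n::finite) chart set"
  assumes atlas: "smooth_atlas S"
begin

section \<open>Charts and coordinate vectors\<close>

lemma chart_domain_open: "(U, \<phi>) \<in> S \<Longrightarrow> open U"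
  and chart_homeomorphism: "(U, \<phi>) \<in> S \<Longrightarrow> homeomorphism U (\<phi> ` U) \<phi> (inv_into U \<phi>)"
  and chart_transition_smooth: "(U, \<phi>) \<in> S \<Longrightarrow> (V, \<psi>) \<in> S \<Longrightarrow>
    smooth_on (\<psi> \<circ> inv_into U \<phi>) (\<phi> ` (U \<inter> V))"
  using atlas unfolding smooth_atlas_def by fast+

lemma chart_at:
  obtains U \<phi> where "(U, \<phi>) \<in> S" "p \<in> U"
  using atlas unfolding smooth_atlas_def by blast

lemma chart_inv_into: "(U, \<phi>) \<in> S \<Longrightarrow> q \<in> U \<Longrightarrow> inv_into U \<phi> (\<phi> q) = q"
  using homeomorphism_apply1[OF chart_homeomorphism] .

lemma chart_image_open:
  assumes c: "(U, \<phi>) \<in> S" and W: "open W"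
  shows "open (\<phi> ` (U \<inter> W))"
proof -
  have "openin (top_of_set (\<phi> ` U)) (\<phi> ` (U \<inter> W))"
    using homeomorphism_imp_open_map[OF chart_homeomorphism[OF c]] W by blast
  moreover have "open (\<phi> ` U)"
    using atlas c unfolding smooth_atlas_def by fast
  ultimately show ?thesis using openin_open_trans by blast
qed

lemma smooth_near_differentiable:
  assumes c: "(U, \<phi>) \<in> S" and p: "p \<in> U" and f: "smooth_near S p f"
  shows "(f \<circ> inv_into U \<phi>) differentiable at (\<phi> p)"
proof -
  obtain W where W: "open W" "p \<in> W" "smooth_fun_on S W f"
    using f unfolding smooth_near_def by blast
  then have "smooth_on (f \<circ> inv_into U \<phi>) (\<phi> ` (U \<inter> W))"
    using c unfolding smooth_fun_on_def by fast
  then show ?thesis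
    using smooth_on_imp_differentiable_at chart_image_open[OF c W(1)] p W(2) by blast
qed

text \<open>On functions that are not smooth near \<open>p\<close> every coordinate vector acts as
  0; on the others linearity is that of the Frechet derivative.\<close>

lemma linear_coord_vector:
  assumes "(U, \<phi>) \<in> S" "p \<in> U"
  shows "linear (coord_vector S (U, \<phi>) p)"
  using linear_frechet_derivative[OF smooth_near_differentiable[OF assms]]
  by (intro linearI functional_eqI) (auto simp: act_coord_vector linear_add linear_cmul)

text \<open>Read in another chart, a coordinate function is a component of a transition map. It is
  smooth on \<open>U\<close> only, which is why smoothness near \<open>p\<close> is the right notion
  here.\<close>

lemma smooth_near_coordinate:
  assumes c: "(U, \<phi>) \<in> S" and p: "p \<in> U"
  shows "smooth_near S p (\<lambda>q. \<phi> q \<bullet> b)"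
proof -
  have "smooth_on ((\<lambda>q. \<phi> q \<bullet> b) \<circ> inv_into V \<psi>) (\<psi> ` (V \<inter> U))" if "(V, \<psi>) \<in> S" for V \<psi>
    using smooth_on_bounded_linear_compose[OF bounded_linear_inner_left
        chart_image_open[OF that chart_domain_open[OF c]] chart_transition_smooth[OF that c], of b]
    by (simp add: o_def)
  then have "smooth_fun_on S U (\<lambda>q. \<phi> q \<bullet> b)"
    unfolding smooth_fun_on_def by fast
  then show ?thesis
    using p chart_domain_open[OF c] unfolding smooth_near_def by blast
qed

text \<open>A coordinate vector applied to the coordinate functions returns the components of its
  direction, so the direction can be recovered.\<close>

lemma inj_coord_vector:
  assumes c: "(U, \<phi>) \<in> S" and p: "p \<in> U"
  shows "inj (coord_vector S (U, \<phi>) p)"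
proof (rule injI)
  fix v w assume eq: "coord_vector S (U, \<phi>) p v = coord_vector S (U, \<phi>) p w"
  have a: "act (coord_vector S (U, \<phi>) p w) (\<lambda>q. \<phi> q \<bullet> b) = w \<bullet> b" for w b
  proof -
    have "((\<lambda>x. x \<bullet> b) has_derivative (\<lambda>x. x \<bullet> b)) (at (\<phi> p))"
      by (rule bounded_linear_imp_has_derivative[OF bounded_linear_inner_left])
    then have "((\<lambda>q. \<phi> q \<bullet> b) \<circ> inv_into U \<phi> has_derivative (\<lambda>x. x \<bullet> b)) (at (\<phi> p))"
      by (rule has_derivative_transform_within_open[OF _ chart_image_open[OF c open_UNIV]])
        (use p chart_inv_into[OF c] in auto)
    from fun_cong[OF frechet_derivative_at[OF this], of w, symmetric] show ?thesis
      by (simp only: act_coord_vector smooth_near_coordinate[OF c p] if_True)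
  qed
  have "v \<bullet> b = w \<bullet> b" for b
    by (metis a eq)
  then show "v = w" by (rule euclidean_eqI)
qed

text \<open>Near \<psi> p the expression of f in the second chart is its expression in the first one
  composed with the transition map, so the chain rule applies.\<close>

lemma coord_vector_change:
  assumes c: "(U, \<phi>) \<in> S" "p \<in> U" and d: "(V, \<psi>) \<in> S" "p \<in> V"
  shows "coord_vector S (V, \<psi>) p w =
    coord_vector S (U, \<phi>) p (frechet_derivative (\<phi> \<circ> inv_into V \<psi>) (at (\<psi> p)) w)"
proof (rule functional_eqI)
  fix f :: "'a \<Rightarrow> real"
  let ?t = "\<phi> \<circ> inv_into V \<psi>" and ?f = "f \<circ> inv_into U \<phi>"
  let ?D = "frechet_derivative ?f (at (\<phi> p)) \<circ> frechet_derivative ?t (at (\<psi> p))"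
  show "act (coord_vector S (V, \<psi>) p w) f =
    act (coord_vector S (U, \<phi>) p (frechet_derivative ?t (at (\<psi> p)) w)) f"
  proof (cases "smooth_near S p f")
    case True
    have op: "open (\<psi> ` (V \<inter> U))"
      using chart_image_open[OF d(1) chart_domain_open[OF c(1)]] .
    have "?t differentiable at (\<psi> p)"
      using smooth_on_imp_differentiable_at[OF chart_transition_smooth[OF d(1) c(1)] op] c d by blast
    moreover have "?f differentiable at (?t (\<psi> p))"
      using smooth_near_differentiable[OF c True] chart_inv_into[OF d] by simp
    moreover have tp: "?t (\<psi> p) = \<phi> p"
      using chart_inv_into[OF d] by simp
    ultimately have "(?f \<circ> ?t has_derivative ?D) (at (\<psi> p))"
      using diff_chain_at[of ?t _ "\<psi> p" ?f] frechet_derivative_works by metis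
    then have "(f \<circ> inv_into V \<psi> has_derivative ?D) (at (\<psi> p))"
      by (rule has_derivative_transform_within_open[OF _ op])
        (use c d chart_inv_into in auto)
    from fun_cong[OF frechet_derivative_at[OF this], of w] show ?thesis
      by (simp add: act_coord_vector True)
  qed (simp add: act_coord_vector)
qed

text \<open>\<open>tangent_space\<close> collects vectors from all charts around the point. Since a
  change of chart only changes the direction, one chart suffices, and the linear structure can be
  read off from it.\<close>

lemma tangent_space_eq_range:
  assumes "(U, \<phi>) \<in> S" "p \<in> U"
  shows "tangent_space S p = range (coord_vector S (U, \<phi>) p)"
proof
  show "tangent_space S p \<subseteq> range (coord_vector S (U, \<phi>) p)"
    unfolding tangent_space_def using coord_vector_change[OF assms] by fast
  show "range (coord_vector S (U, \<phi>) p) \<subseteq> tangent_space S p"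
    unfolding tangent_space_def using assms by fast
qed

section \<open>Linear structure and dimension of tangent spaces\<close>

lemma subspace_tangent_space: "subspace (tangent_space S p)"
proof -
  obtain U \<phi> where c: "(U, \<phi>) \<in> S" "p \<in> U" by (rule chart_at)
  show ?thesis
    unfolding tangent_space_eq_range[OF c]
    by (rule linear_subspace_image[OF linear_coord_vector[OF c] subspace_UNIV])
qed

lemma tangent_space_basis:
  obtains B where "finite B" "independent B" "span B = tangent_space S p" "card B = CARD('n)"
proof -
  obtain U \<phi> where c: "(U, \<phi>) \<in> S" "p \<in> U" by (rule chart_at)
  let ?L = "coord_vector S (U, \<phi>) p"
  note L = linear_coord_vector[OF c] and inj = inj_coord_vector[OF c]
  show ?thesis
  proof
    show "finite (?L ` Basis)" by simp
    show "independent (?L ` Basis)"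
      using linear_independent_injective_image[OF L independent_Basis] inj by simp
    show "span (?L ` Basis) = tangent_space S p"
      by (simp add: linear_span_image[OF L] tangent_space_eq_range[OF c])
    show "card (?L ` Basis) = CARD('n)"
      using card_image[OF inj_on_subset[OF inj subset_UNIV]] by simp
  qed
qed

lemma tangent_space_not_span2:
  assumes "CARD('n) > 2"
  obtains z where "z \<in> tangent_space S p" "z \<notin> span {x, y}"
proof -
  obtain B where B: "finite B" "independent B" "span B = tangent_space S p" "card B = CARD('n)"
    by (rule tangent_space_basis)
  have "\<not> tangent_space S p \<subseteq> span {x, y}"
  proof
    assume "tangent_space S p \<subseteq> span {x, y}"
    then have "B \<subseteq> span {x, y}" using B(3) span_superset[of B] by simp
    then have "card B \<le> card {x, y}" using independent_span_bound[OF _ B(2)] by simp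
    moreover have "card {x, y} \<le> 2" by (simp add: card_insert_le_m1)
    ultimately show False using B(4) assms by simp
  qed
  then show thesis using that by blast
qed

text \<open>Take the coordinate field with constant direction \<open>w\<close>, damp it by a bump
  function supported in the chart and continue it by zero.\<close>

lemma vector_field_extension:
  assumes v: "v \<in> tangent_space S p"
  obtains X where "X \<in> vector_fields S" "X p = v"
proof -
  obtain U \<phi> where c: "(U, \<phi>) \<in> S" "p \<in> U" by (rule chart_at)
  note inv = chart_inv_into[OF c(1)]
  obtain w where w: "v = coord_vector S (U, \<phi>) p w"
    using v unfolding tangent_space_eq_range[OF c] by (rule rangeE)
  have "open (\<phi> ` U)" using chart_image_open[OF c(1) open_UNIV] by simp
  then obtain r where r: "r > 0" "cball (\<phi> p) r \<subseteq> \<phi> ` U"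
    using c(2) by (meson imageI open_contains_cball)
  obtain \<beta> :: "real ^ 'n \<Rightarrow> real" where \<beta>: "smooth_on \<beta> UNIV" "\<beta> (\<phi> p) \<noteq> 0" "\<And>x. x \<notin> cball (\<phi> p) r \<Longrightarrow> \<beta> x = 0"
    by (rule exists_smooth_bump[where a = "\<phi> p", OF r(1)]) blast
  define X where "X = (\<lambda>q. if q \<in> U then (\<beta> (\<phi> q) / \<beta> (\<phi> p)) *\<^sub>R coord_vector S (U, \<phi>) q w else 0)"
  \<comment> \<open>\<open>K\<close> contains the support of \<open>X\<close>. As a compact set it
    is closed in the Hausdorff manifold, so \<open>U\<close> and \<open>- K\<close> are open; they
    cover the manifold because \<open>K\<close> lies in \<open>U\<close>. Smoothness is checked on
    each of them.\<close>
  define K where "K = inv_into U \<phi> ` cball (\<phi> p) r"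
  have "continuous_on (\<phi> ` U) (inv_into U \<phi>)"
    using chart_homeomorphism[OF c(1)] homeomorphism_cont2 by blast
  then have "compact K"
    unfolding K_def using r(2) by (intro compact_continuous_image) (auto intro: continuous_on_subset)
  then have K: "open (- K)" using compact_imp_closed by blast
  have "K \<subseteq> U" unfolding K_def using r(2) inv by auto
  have X0: "X q = 0" if "q \<notin> K" for q
  proof -
    have "\<beta> (\<phi> q) = 0" if "q \<in> U"
      using \<beta>(3) inv[OF that] \<open>q \<notin> K\<close> unfolding K_def by (metis image_eqI)
    then show ?thesis by (simp add: X_def)
  qed
  have "X q \<in> tangent_space S q" for q
  proof (cases "q \<in> U")
    case True
    then show ?thesis
      using subspace_scale[OF subspace_tangent_space, of "coord_vector S (U, \<phi>) q w" q]
      by (simp add: X_def tangent_space_eq_range[OF c(1) True])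
  qed (simp add: X_def subspace_0[OF subspace_tangent_space])
  moreover have "smooth_fun_on S W (deriv_along X f)" if W: "open W" and f: "smooth_fun_on S W f" for W f
    unfolding smooth_fun_on_def
  proof clarify
    fix V \<psi> assume d: "(V, \<psi>) \<in> S"
    note inv' = chart_inv_into[OF d]
    show "smooth_on (deriv_along X f \<circ> inv_into V \<psi>) (\<psi> ` (V \<inter> W))"
    proof (rule smooth_on_open_cover)
      fix x assume "x \<in> \<psi> ` (V \<inter> W)"
      then obtain q where q: "x = \<psi> q" "q \<in> V" "q \<in> W" by blast
      show "\<exists>T. open T \<and> x \<in> T \<and> smooth_on (deriv_along X f \<circ> inv_into V \<psi>) T"
      proof (cases "q \<in> U")
        case True
        let ?T = "\<psi> ` (V \<inter> (W \<inter> U))"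
        \<comment> \<open>This is the derivative of \<open>f\<close> along \<open>X\<close> read in
          the chart \<phi>; composing it with the transition map gives the expression in the chart
          \<psi>.\<close>
        let ?H = "\<lambda>x. (\<beta> x / \<beta> (\<phi> p)) *\<^sub>R frechet_derivative (f \<circ> inv_into U \<phi>) (at x) w"
        have T: "open ?T"
          using chart_image_open[OF d] W chart_domain_open[OF c(1)] by blast
        have UW: "open (\<phi> ` (U \<inter> W))" using chart_image_open[OF c(1) W] .
        have "smooth_on ?H (\<phi> ` (U \<inter> W))"
        proof (rule smooth_on_scaleR[OF UW])
          show "smooth_on (\<lambda>x. \<beta> x / \<beta> (\<phi> p)) (\<phi> ` (U \<inter> W))"
            by (rule smooth_on_bounded_linear_compose[OF bounded_linear_divide UW])
              (rule smooth_on_subset[OF \<beta>(1) subset_UNIV])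
          show "smooth_on (\<lambda>x. frechet_derivative (f \<circ> inv_into U \<phi>) (at x) w) (\<phi> ` (U \<inter> W))"
            by (rule smooth_on_frechet_derivative[OF _ UW])
              (use f c in \<open>auto simp: smooth_fun_on_def\<close>)
        qed
        moreover have "smooth_on (\<phi> \<circ> inv_into V \<psi>) ?T"
          by (rule smooth_on_subset[OF chart_transition_smooth[OF d c(1)]]) auto
        moreover have "(\<phi> \<circ> inv_into V \<psi>) ` ?T \<subseteq> \<phi> ` (U \<inter> W)"
          using inv' by auto
        ultimately have "smooth_on (?H \<circ> (\<phi> \<circ> inv_into V \<psi>)) ?T"
          using smooth_on_compose[OF T UW] by blast
        moreover have "(?H \<circ> (\<phi> \<circ> inv_into V \<psi>)) y = (deriv_along X f \<circ> inv_into V \<psi>) y"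
          if y: "y \<in> ?T" for y
        proof -
          obtain q' where q': "y = \<psi> q'" "q' \<in> V" "q' \<in> W" "q' \<in> U" using y by blast
          \<comment> \<open>Without this fact the coordinate vector would act on \<open>f\<close> by
            its default value 0 rather than by differentiation.\<close>
          then have "smooth_near S q' f" using W f unfolding smooth_near_def by blast
          then show ?thesis
            using q' inv' by (simp add: deriv_along_def X_def act_coord_vector)
        qed
        ultimately have "smooth_on (deriv_along X f \<circ> inv_into V \<psi>) ?T"
          using smooth_on_cong[OF T] by blast
        then show ?thesis using T q True by blast
      next
        case False
        let ?T = "\<psi> ` (V \<inter> - K)"
        have T: "open ?T" using chart_image_open[OF d K] .
        have "smooth_on (deriv_along X f \<circ> inv_into V \<psi>) ?T"
          by (rule smooth_on_cong[OF T _ smooth_on_const[of 0]])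
            (use inv' X0 in \<open>auto simp: deriv_along_def\<close>)
        then show ?thesis using T q False \<open>K \<subseteq> U\<close> by blast
      qed
    qed
  qed
  ultimately have "X \<in> vector_fields S" by (simp add: vector_fields_def)
  moreover have "X p = v" using c(2) \<beta>(2) w by (simp add: X_def)
  ultimately show thesis using that by blast
qed

section \<open>Extensions and Ricci traces\<close>

lemma extension_in_vector_fields:
  assumes "v \<in> tangent_space S p"
  shows "extension S p v \<in> vector_fields S"
proof -
  have "\<exists>X. X \<in> vector_fields S \<and> X p = v"
    using vector_field_extension[OF assms] by blast
  then show ?thesis unfolding extension_def by (rule someI2_ex) simp
qed

lemma ricci_eq_0:
  assumes "\<And>X. X \<in> vector_fields S \<Longrightarrow> T X Y Z p = 0"
  shows "ricci S T Y Z p = 0"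
proof -
  \<comment> \<open>This is the very basis chosen in \<open>trace_on\<close>. That a basis exists
    guarantees that its elements are tangent vectors, whose extensions are vector fields; the
    endomorphism therefore vanishes on all of them.\<close>
  define B where "B = (SOME B. finite B \<and> independent B \<and> span B = tangent_space S p)"
  have "\<exists>B. finite B \<and> independent B \<and> span B = tangent_space S p"
    using tangent_space_basis by metis
  then have "finite B \<and> independent B \<and> span B = tangent_space S p"
    unfolding B_def by (rule someI_ex)
  then have "B \<subseteq> tangent_space S p" using span_superset by blast
  then have "T (extension S p b) Y Z p = 0" if "b \<in> B" for b
    using assms extension_in_vector_fields that by blast
  then show ?thesis
    unfolding ricci_def trace_on_def Let_def B_def[symmetric]
    by (simp add: representation_zero)
qed

end


lemma kahler_manifoldD:
  fixes S :: "('a::{t2_space, second_countable_topology}, 'n::finite) chart set"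
  assumes "kahler_manifold S g A nabla"
  shows "smooth_atlas S" "CARD('n) \<ge> 4" "tensor11 S A"
    "\<forall>p. \<forall>v\<in>tangent_space S p. A p (A p v) = - v"
  using assms by (simp_all add: kahler_manifold_def)

section \<open>Vanishing of the curvature\<close>

lemma riemann_eq_0:
  fixes S :: "('a::{t2_space, second_countable_topology}, 'n::finite) chart set"
  assumes K: "kahler_manifold S g A nabla"
    and H1: "\<And>X Y Z. X \<in> vector_fields S \<Longrightarrow> Y \<in> vector_fields S \<Longrightarrow> Z \<in> vector_fields S \<Longrightarrow>
      H1 S A nabla \<pi> X Y Z p = 0"
    and H2: "\<And>X Y Z. X \<in> vector_fields S \<Longrightarrow> Y \<in> vector_fields S \<Longrightarrow> Z \<in> vector_fields S \<Longrightarrow>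
      H2 S A nabla \<pi> X Y Z p = 0"
    and X: "X \<in> vector_fields S" and Y: "Y \<in> vector_fields S" and Z: "Z \<in> vector_fields S"
  shows "riemann S nabla X Y Z p = 0"
proof -
  note K' = kahler_manifoldD[OF K]
  note atlas = K'(1) and A = K'(3)[unfolded tensor11_def, THEN conjunct1, rule_format, of _ p]
    and AA = K'(4)[rule_format, of _ p]
  have dim: "CARD('n) > 2" using K'(2) by linarith
  have A_lin: "A p (v + w) = A p v + A p w" "A p (k *\<^sub>R v) = k *\<^sub>R A p v"
    if "v \<in> tangent_space S p" "w \<in> tangent_space S p" for v w k
    using A[OF that, of k] by blast+
  have A_closed: "A p v \<in> tangent_space S p" if "v \<in> tangent_space S p" for v
    using A[OF that that] by blast
  have tan: "V p \<in> tangent_space S p" if "V \<in> vector_fields S" for V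
    using that unfolding vector_fields_def by blast
  \<comment> \<open>The coefficient in \<open>H1\<close> does not involve the third argument, so
    \<open>c\<close> may be determined from any convenient \<open>Z'\<close>.\<close>
  define c where "c = D1 nabla \<pi> X Y p - ricci S (curvature1 S A nabla \<pi>) Y (app A X) p"
  have R1: "riemann S nabla X Y Z' p = c *\<^sub>R A p (Z' p)" if "Z' \<in> vector_fields S" for Z'
    using H1[OF X Y that] by (simp add: H1_def Let_def curvature1_def app_def c_def algebra_simps)
  obtain z where z: "z \<in> tangent_space S p" "z \<notin> span {X p, Y p}"
    by (rule tangent_space_not_span2[OF atlas dim])
  obtain Z' where Z': "Z' \<in> vector_fields S" "Z' p = z"
    by (rule vector_field_extension[OF atlas z(1)])
  \<comment> \<open>With \<open>Z'\<close> fixed, both coefficients left by \<open>H2 = 0\<close>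
    are values of one function, at \<open>X\<close> and, with the opposite sign, at
    \<open>Y\<close>.\<close>
  define a where "a = (\<lambda>U. D2 A nabla \<pi> U Z' p - ricci S (curvature2 S A nabla \<pi>) (app A U) Z' p)"
  have "riemann S nabla X Y Z' p = a X *\<^sub>R A p (Y p) + (- a Y) *\<^sub>R A p (X p)"
    using H2[OF X Y Z'(1)] by (simp add: H2_def Let_def curvature2_def app_def a_def algebra_simps)
  with R1[OF Z'(1)] have "c *\<^sub>R A p z = a X *\<^sub>R A p (Y p) + (- a Y) *\<^sub>R A p (X p)"
    using Z'(2) by simp
  \<comment> \<open>Applying \<open>A\<close> once more and using that its square is minus the
    identity strips \<open>A\<close> from all three vectors.\<close>
  then have "A p (c *\<^sub>R A p z) = A p (a X *\<^sub>R A p (Y p) + (- a Y) *\<^sub>R A p (X p))"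
    by simp
  then have "c *\<^sub>R (- z) = a X *\<^sub>R (- Y p) + (- a Y) *\<^sub>R (- X p)"
    using z(1) tan[OF X] tan[OF Y]
    by (simp only: A_lin A_closed AA subspace_scale[OF subspace_tangent_space[OF atlas]])
  then have "c *\<^sub>R z = a X *\<^sub>R Y p + (- a Y) *\<^sub>R X p"
    by (simp add: algebra_simps)
  moreover have "a X *\<^sub>R Y p + (- a Y) *\<^sub>R X p \<in> span {X p, Y p}"
    by (intro span_add span_scale span_base) auto
  ultimately have "c *\<^sub>R z \<in> span {X p, Y p}" by simp
  \<comment> \<open>Otherwise dividing by \<open>c\<close> would put \<open>z\<close> into the span
    of \<open>X p\<close> and \<open>Y p\<close>.\<close>
  then have "c = 0"
    using z(2) span_scale[of "c *\<^sub>R z" "{X p, Y p}" "inverse c"] by (cases "c = 0") simp_all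
  then show ?thesis using R1[OF Z] by simp
qed

theorem theorem5p3:
  fixes S :: "('a::{t2_space, second_countable_topology}, 'n::finite) chart set"
    and g :: "'a \<Rightarrow> 'a functional \<Rightarrow> 'a functional \<Rightarrow> real"
    and A :: "'a \<Rightarrow> 'a functional \<Rightarrow> 'a functional"
    and \<pi> :: "'a \<Rightarrow> 'a functional \<Rightarrow> real"
    and nabla nabla1 :: "'a connection"
  assumes "kahler_manifold S g A nabla"
    and "one_form S \<pi>"
    and "quarter_symmetric_metric_A_connection S g A \<pi> nabla1"
    and "\<forall>X\<in>vector_fields S. \<forall>Y\<in>vector_fields S. \<forall>p.
           nabla1 X Y p = nabla X Y p - \<pi> p (X p) *\<^sub>R app A Y p"
    and "\<forall>X\<in>vector_fields S. \<forall>Y\<in>vector_fields S. \<forall>Z\<in>vector_fields S. \<forall>p.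
           H1 S A nabla \<pi> X Y Z p = 0"
    and "\<forall>X\<in>vector_fields S. \<forall>Y\<in>vector_fields S. \<forall>Z\<in>vector_fields S. \<forall>p.
           H2 S A nabla \<pi> X Y Z p = 0"
  shows "\<forall>X\<in>vector_fields S. \<forall>Y\<in>vector_fields S. \<forall>Z\<in>vector_fields S. \<forall>p.
           holomorphically_projective S A nabla X Y Z p =
             ((real CARD('n) - 1) / (real CARD('n) + 2)) *\<^sub>R weyl_projective S nabla X Y Z p"
proof -
  note atlas = kahler_manifoldD(1)[OF assms(1)]
  \<comment> \<open>The holomorphically projective tensor evaluates the Ricci tensor at
    \<open>app A Y\<close> and \<open>app A Z\<close>, so its vanishing there requires these to be
    vector fields.\<close>
  have app: "app A X \<in> vector_fields S" if "X \<in> vector_fields S" for X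
    using kahler_manifoldD(3)[OF assms(1), unfolded tensor11_def, THEN conjunct2] that by (rule bspec)
  have R: "riemann S nabla X Y Z p = 0"
    if "X \<in> vector_fields S" "Y \<in> vector_fields S" "Z \<in> vector_fields S" for X Y Z p
    by (rule riemann_eq_0[OF assms(1)]) (use assms(5,6) that in auto)
  have "ricci S (riemann S nabla) Y Z p = 0"
    if "Y \<in> vector_fields S" "Z \<in> vector_fields S" for Y Z p
    by (rule ricci_eq_0[OF atlas]) (use R that in blast)
  with R app show ?thesis
    by (simp add: holomorphically_projective_def weyl_projective_def Let_def)
qed

end
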